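(* Let $\mathrm{hsp}(n,k)$ denote the sum of the heights of all symmetric peaks over all compositions of $n$ with exactly $k$ parts. (1) For $n\geq 0$ and $k>3$, $$\mathrm{hsp}(n,k)=(k-2)\sum_{m=2}^{n-k+1}\ \sum_{b=1}^{\min\{m-1,t\}}\binom{n-2b-m-1}{k-4}(m-b),$$ where $t=\left\lfloor \frac{n-m-k+3}{2}\right\rfloor$. (2) When $k=3$, $$\mathrm{hsp}(n,3)=\sum_{m=2}^{n-2}h_m,$$ where $h_m=\frac{3m-n}{2}$ if $\frac{n-m}{2}$ is an integer, and $h_m=0$ otherwise.
   Context: A composition of $n$ with $k$ parts is a sequence $\pi=\pi_1\pi_2\cdots\pi_k$ of positive integers with $\sum_{i=1}^k\pi_i=n$. A symmetric peak of $\pi$ is a triple of consecutive parts $\pi_i\pi_{i+1}\pi_{i+2}$ ($1\le i\le k-2$) with $\pi_i<\pi_{i+1}$ and $\pi_i=\pi_{i+2}$; its height is $\pi_{i+1}-\pi_i$. The quantity $\mathrm{hsp}(n,k)$ sums the heights over all pairs (composition $\pi$ of $n$ with exactly $k$ parts, position $i$ of a symmetric peak of $\pi$).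
   Formalization: In (2), h_m = (3m-n)/2 is used only if (n-m)/2 is an integer and (n-m)/2 < m, and h_m = 0 otherwise; as printed the formula is false, e.g. for n = 8 it gives 6 while hsp(8,3) = 7. *)

theory Defs
  imports Complex_Main
begin

definition compositions :: "nat \<Rightarrow> nat \<Rightarrow> nat list set" where
  "compositions n k = {p. length p = k \<and> (\<forall>x\<in>set p. 0 < x) \<and> sum_list p = n}"

lemma finite_compositions: "finite (compositions n k)"
proof (rule finite_subset)
  show "compositions n k \<subseteq> {p. set p \<subseteq> {..n} \<and> length p = k}"
    by (auto simp: compositions_def member_le_sum_list)
  show "finite {p. set p \<subseteq> {..n} \<and> length p = k}"
    by (rule finite_lists_length_eq) simp
qed

(* Positions are counted from 0. *)
definition sym_peaks :: "nat list \<Rightarrow> nat set" where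
  "sym_peaks p = {i. i + 2 < length p \<and> p ! i < p ! (i + 1) \<and> p ! i = p ! (i + 2)}"

definition peak_height :: "nat list \<Rightarrow> nat \<Rightarrow> int" where
  "peak_height p i = int (p ! (i + 1)) - int (p ! i)"

definition hsp :: "nat \<Rightarrow> nat \<Rightarrow> int" where
  "hsp n k = (\<Sum>p\<in>compositions n k. \<Sum>i\<in>sym_peaks p. peak_height p i)"

(* The value h_m.  It is the height of the only candidate peak b m b with
   2 * b + m = n, namely m - b = (3 * m - n) / 2, so it counts only if b is an
   integer and b < m.  The condition b < m cannot be dropped: without it the
   terms with 3 * m < n would be negative, and for n = 8 the sum over
   m = 2, ..., 6 would be 6, while hsp 8 3 = 7 (from 1 6 1 and 2 4 2). *)
definition mid_height :: "nat \<Rightarrow> int \<Rightarrow> real" where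
  "mid_height n m =
     (if (real n - of_int m) / 2 \<in> \<int> \<and> (real n - of_int m) / 2 < of_int m
      then (3 * of_int m - real n) / 2 else 0)"

end

theory Submission
  imports Defs
begin

text \<open>
  A symmetric peak \<open>b m b\<close> at a fixed position of a composition of \<open>n\<close> with \<open>k\<close> parts can be
  cut out, which leaves an arbitrary composition of \<open>n - 2b - m\<close> with \<open>k - 3\<close> parts; conversely
  the three parts can be inserted at that position into any such composition.  So every one of the
  \<open>k - 2\<close> positions contributes the same amount to \<open>hsp n k\<close>: the sum, over all \<open>0 < b < m\<close>, of
  the height \<open>m - b\<close> times the number of compositions of \<open>n - 2b - m\<close> with \<open>k - 3\<close> parts
  (\<open>hsp_eq_sum_peaks\<close>).

  For \<open>k > 3\<close> this number is the binomial coefficient of \<open>n - 2b - m - 1\<close> over \<open>k - 4\<close>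
  (\<open>card_compositions\<close>), and the pairs \<open>(m, b)\<close> for which \<open>n - 2b - m\<close> is large enough to be
  split into \<open>k - 3\<close> positive parts are those of the stated double sum.  For \<open>k = 3\<close> nothing is
  left over, so only the pairs with \<open>2b + m = n\<close> count: \<open>m\<close> determines \<open>b = (n - m) / 2\<close>.
\<close>

section \<open>Counting compositions\<close>

text \<open>Subtracting 1 from every part turns compositions into weak compositions, which stars and
  bars counts.\<close>

lemma card_compositions:
  assumes "0 < k" "k \<le> n"
  shows "card (compositions n k) = (n - 1) choose (k - 1)"
proof -
  have "bij_betw (map Suc) {l. length l = k \<and> sum_list l = n - k} (compositions n k)"
  proof (rule bij_betw_byWitness[where f' = "map (\<lambda>x. x - 1)"])
    have sum_Suc: "sum_list (map Suc l) = sum_list l + length l" for l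
      by (induction l) auto
    have sum_pred: "sum_list (map (\<lambda>x. x - 1) l) + length l = sum_list l"
      if "\<forall>x\<in>set l. 0 < x" for l :: "nat list"
      using that by (induction l) auto
    show "map Suc ` {l. length l = k \<and> sum_list l = n - k} \<subseteq> compositions n k"
      using assms by (auto simp: compositions_def sum_Suc)
    show "map (\<lambda>x. x - 1) ` compositions n k \<subseteq> {l. length l = k \<and> sum_list l = n - k}"
      using sum_pred by (fastforce simp: compositions_def)
    show "\<forall>l\<in>compositions n k. map Suc (map (\<lambda>x. x - 1) l) = l"
      by (auto simp: compositions_def intro!: map_idI)
  qed (auto intro: map_idI)
  then have "card (compositions n k) = card {l::nat list. length l = k \<and> sum_list l = n - k}"
    by (simp add: bij_betw_same_card)
  also have "\<dots> = (n - 1) choose (n - k)"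
    using assms by (simp add: card_length_sum_list)
  also have "\<dots> = (n - 1) choose (k - 1)"
    using assms binomial_symmetric[of "n - k" "n - 1"] by simp
  finally show ?thesis .
qed

lemma compositions_0: "compositions n 0 = (if n = 0 then {[]} else {})"
  by (auto simp: compositions_def)

lemma length_le_sum_list:
  fixes xs :: "nat list"
  assumes "\<forall>x\<in>set xs. 0 < x"
  shows "length xs \<le> sum_list xs"
  using assms by (induction xs) auto

section \<open>Cutting out a peak\<close>

definition insert_peak :: "nat \<Rightarrow> nat \<Rightarrow> nat \<Rightarrow> nat list \<Rightarrow> nat list" where
  "insert_peak i m b q = take i q @ b # m # b # drop i q"

definition cut_out3 :: "nat \<Rightarrow> nat list \<Rightarrow> nat list" where
  "cut_out3 i p = take i p @ drop (i + 3) p"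

lemma insert_peak_cut_out3:
  assumes "i \<in> sym_peaks p"
  shows "insert_peak i (p ! (i + 1)) (p ! i) (cut_out3 i p) = p"
proof -
  have i: "i + 2 < length p" "p ! (i + 2) = p ! i"
    using assms by (auto simp: sym_peaks_def)
  have "drop i p = p ! i # p ! (i + 1) # p ! (i + 2) # drop (i + 3) p"
    using i by (simp add: Cons_nth_drop_Suc[symmetric] numeral_3_eq_3)
  then have "p = take i p @ p ! i # p ! (i + 1) # p ! i # drop (i + 3) p"
    using i append_take_drop_id[of i p] by metis
  then show ?thesis
    using i by (simp add: insert_peak_def cut_out3_def)
qed

lemma cut_out3_insert_peak:
  assumes "i \<le> length q"
  shows "cut_out3 i (insert_peak i m b q) = q"
  using assms by (simp add: cut_out3_def insert_peak_def)

lemma nth_insert_peak: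
  assumes "i \<le> length q"
  shows "insert_peak i m b q ! i = b" "insert_peak i m b q ! (i + 1) = m"
    "insert_peak i m b q ! (i + 2) = b"
  using assms by (simp_all add: insert_peak_def nth_append)

lemma length_insert_peak: "length (insert_peak i m b q) = length q + 3"
  by (simp add: insert_peak_def)

lemma set_insert_peak: "set (insert_peak i m b q) = {b, m} \<union> set q"
proof -
  have "set q = set (take i q) \<union> set (drop i q)"
    by (metis append_take_drop_id set_append)
  then show ?thesis
    by (auto simp: insert_peak_def)
qed

lemma sum_list_insert_peak: "sum_list (insert_peak i m b q) = 2 * b + m + sum_list q"
proof -
  have "sum_list q = sum_list (take i q) + sum_list (drop i q)"
    by (metis append_take_drop_id sum_list_append)
  then show ?thesis
    by (simp add: insert_peak_def)
qed

lemma insert_peak_in_compositions_iff: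
  "insert_peak i m b q \<in> compositions n (l + 3) \<longleftrightarrow>
     0 < b \<and> 0 < m \<and> 2 * b + m \<le> n \<and> q \<in> compositions (n - 2 * b - m) l"
  by (auto simp: compositions_def length_insert_peak set_insert_peak sum_list_insert_peak)

text \<open>The values \<open>(m, b)\<close> of the peaks \<open>b m b\<close> that leave enough room for \<open>l\<close> further parts.\<close>

definition peak_values :: "nat \<Rightarrow> nat \<Rightarrow> (nat \<times> nat) set" where
  "peak_values n l = {(m, b). 0 < b \<and> b < m \<and> 2 * b + m + l \<le> n}"

lemma finite_peak_values: "finite (peak_values n l)"
  by (rule finite_subset[of _ "{..n} \<times> {..n}"]) (auto simp: peak_values_def)

text \<open>Cutting the peak out of the composition is a bijection, whose inverse inserts it.  The
  result does not depend on the position \<open>i\<close>.\<close>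

lemma sum_peak_height_at:
  assumes "i \<le> l"
  shows "(\<Sum>p | p \<in> compositions n (l + 3) \<and> i \<in> sym_peaks p. peak_height p i) =
    (\<Sum>(m, b)\<in>peak_values n l. int (card (compositions (n - 2 * b - m) l)) * (int m - int b))"
proof -
  let ?rest = "\<lambda>(m, b). compositions (n - 2 * b - m) l"
  have "(\<Sum>p | p \<in> compositions n (l + 3) \<and> i \<in> sym_peaks p. peak_height p i) =
      (\<Sum>((m, b), q)\<in>Sigma (peak_values n l) ?rest. int m - int b)"
  proof (rule sum.reindex_bij_witness[where
        j = "\<lambda>p. ((p ! (i + 1), p ! i), cut_out3 i p)" and
        i = "\<lambda>((m, b), q). insert_peak i m b q"], goal_cases)
    case (1 p)
    then show ?case using insert_peak_cut_out3[of i p] by simp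
  next
    case (2 p)
    let ?m = "p ! (i + 1)" and ?b = "p ! i" and ?q = "cut_out3 i p"
    have "insert_peak i ?m ?b ?q \<in> compositions n (l + 3)"
      using 2 insert_peak_cut_out3[of i p] by simp
    then have *: "0 < ?b" "2 * ?b + ?m \<le> n" "?q \<in> compositions (n - 2 * ?b - ?m) l"
      by (simp_all add: insert_peak_in_compositions_iff)
    then have "l \<le> n - 2 * ?b - ?m"
      using length_le_sum_list[of ?q] by (simp add: compositions_def)
    moreover have "?b < ?m"
      using 2 by (simp add: sym_peaks_def)
    ultimately show ?case
      using * by (simp add: peak_values_def)
  next
    case (3 x)
    then show ?case
      using assms nth_insert_peak(2)
      by (auto simp: compositions_def nth_insert_peak(1) cut_out3_insert_peak
          simp del: One_nat_def add_Suc_right)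
  next
    case (4 x)
    obtain m b q where x: "x = ((m, b), q)" by (metis prod.exhaust)
    have q: "q \<in> compositions (n - 2 * b - m) l" "0 < b" "b < m" "2 * b + m \<le> n"
      using 4 by (auto simp: x peak_values_def)
    then have "i \<le> length q"
      using assms by (simp add: compositions_def)
    then have "i \<in> sym_peaks (insert_peak i m b q)"
      using q nth_insert_peak[of i q m b] by (simp add: sym_peaks_def length_insert_peak)
    then show ?case
      using q by (simp add: x insert_peak_in_compositions_iff)
  next
    case (5 p)
    then show ?case by (simp add: peak_height_def)
  qed
  also have "\<dots> = (\<Sum>x\<in>peak_values n l. \<Sum>q\<in>?rest x. int (fst x) - int (snd x))"
    by (subst sum.Sigma) (auto simp: finite_peak_values finite_compositions case_prod_unfold)
  also have "\<dots> = (\<Sum>(m, b)\<in>peak_values n l.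
      int (card (compositions (n - 2 * b - m) l)) * (int m - int b))"
    by (simp add: case_prod_unfold)
  finally show ?thesis .
qed

lemma hsp_eq_sum_peaks:
  "hsp n (l + 3) = (int l + 1) *
    (\<Sum>(m, b)\<in>peak_values n l. int (card (compositions (n - 2 * b - m) l)) * (int m - int b))"
proof -
  have "hsp n (l + 3) = (\<Sum>p\<in>compositions n (l + 3). \<Sum>i | i \<in> {..l} \<and> i \<in> sym_peaks p. peak_height p i)"
    unfolding hsp_def
    by (intro sum.cong refl) (auto simp: compositions_def sym_peaks_def)
  also have "\<dots> = (\<Sum>i\<le>l. \<Sum>p | p \<in> compositions n (l + 3) \<and> i \<in> sym_peaks p. peak_height p i)"
    by (rule sum.swap_restrict) (simp_all add: finite_compositions)
  also have "\<dots> = (\<Sum>i\<le>l. \<Sum>(m, b)\<in>peak_values n l.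
      int (card (compositions (n - 2 * b - m) l)) * (int m - int b))"
    by (intro sum.cong refl sum_peak_height_at) simp
  also have "\<dots> = (int l + 1) * (\<Sum>(m, b)\<in>peak_values n l.
      int (card (compositions (n - 2 * b - m) l)) * (int m - int b))"
    by simp
  finally show ?thesis .
qed

section \<open>The two formulas\<close>

text \<open>The double sum of the theorem runs over the same pairs, read as integers: its upper limit for
  \<open>b\<close> says \<open>b < m\<close> and \<open>2b + m + (k - 3) \<le> n\<close>, and for the second condition some \<open>b > 0\<close> exists
  only if \<open>m \<le> n - k + 1\<close>.\<close>

lemma hsp_more_than_three_parts:
  assumes "3 < k"
  shows "hsp n k = (int k - 2) *
    (\<Sum>m = 2..int n - int k + 1. \<Sum>b = 1..min (m - 1) ((int n - m - int k + 3) div 2).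
      int (nat (int n - 2 * b - m - 1) choose (k - 4)) * (m - b))"
proof -
  define l where "l = k - 3"
  have k: "k = l + 3" and l: "0 < l"
    using assms by (auto simp: l_def)
  let ?B = "\<lambda>m. {1..min (m - 1) ((int n - m - int k + 3) div 2)}"
  have "(\<Sum>(m, b)\<in>peak_values n l. int (card (compositions (n - 2 * b - m) l)) * (int m - int b)) =
      (\<Sum>(m, b)\<in>peak_values n l. int ((n - 2 * b - m - 1) choose (l - 1)) * (int m - int b))"
    using l by (intro sum.cong refl) (auto simp: peak_values_def card_compositions)
  also have "\<dots> = (\<Sum>(m, b)\<in>Sigma {2..int n - int k + 1} ?B.
      int (nat (int n - 2 * b - m - 1) choose (k - 4)) * (m - b))"
  proof (rule sum.reindex_bij_witness[where
        j = "\<lambda>(m, b). (int m, int b)" and i = "\<lambda>(m, b). (nat m, nat b)"], goal_cases)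
    case (5 x)
    have "nat (int n - 2 * int b - int m - 1) = n - 2 * b - m - 1" for m b
      by simp
    then show ?case
      by (auto simp: k split: prod.split)
  qed (auto simp: peak_values_def k)
  also have "\<dots> = (\<Sum>m = 2..int n - int k + 1. \<Sum>b\<in>?B m.
      int (nat (int n - 2 * b - m - 1) choose (k - 4)) * (m - b))"
    by (subst sum.Sigma) auto
  finally show ?thesis
    using hsp_eq_sum_peaks[of n l] by (simp add: k)
qed

text \<open>For \<open>b = (n - m) / 2\<close> the condition \<open>b < m\<close> reads \<open>n < 3m\<close>; in this form it is about
  integers, like the summation index.\<close>

lemma mid_height_eq:
  "mid_height n m = (if even (int n - m) \<and> int n < 3 * m then (3 * of_int m - real n) / 2 else 0)"
proof -
  have "(real n - of_int m) / 2 \<in> \<int> \<longleftrightarrow> even (int n - m)"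
  proof
    assume "(real n - of_int m) / 2 \<in> \<int>"
    then obtain c where "(real n - of_int m) / 2 = of_int c"
      by (auto elim: Ints_cases)
    then have "real_of_int (int n - m) = of_int (2 * c)"
      by simp
    then have "int n - m = 2 * c"
      by (simp only: of_int_eq_iff)
    then show "even (int n - m)"
      by simp
  next
    assume "even (int n - m)"
    then obtain c where "int n - m = 2 * c" ..
    then have "real_of_int (int n - m) = of_int (2 * c)"
      by simp
    then have "(real n - of_int m) / 2 = of_int c"
      by simp
    then show "(real n - of_int m) / 2 \<in> \<int>"
      by simp
  qed
  moreover have "(real n - of_int m) / 2 < of_int m \<longleftrightarrow> int n < 3 * m"
  proof -
    have "(real n - of_int m) / 2 < of_int m \<longleftrightarrow> real_of_int (int n) < real_of_int (3 * m)"
      by (simp add: field_simps)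
    then show ?thesis
      by (simp only: of_int_less_iff)
  qed
  ultimately show ?thesis
    by (simp add: mid_height_def)
qed

lemma hsp_three_parts: "real_of_int (hsp n 3) = (\<Sum>m = 2..int n - 2. mid_height n m)"
proof -
  have "hsp n 3 = (\<Sum>(m, b)\<in>peak_values n 0.
      int (card (compositions (n - 2 * b - m) 0)) * (int m - int b))"
    using hsp_eq_sum_peaks[of n 0] by simp
  also have "\<dots> = (\<Sum>(m, b) | 0 < b \<and> b < m \<and> 2 * b + m = n. int m - int b)"
    by (intro sum.mono_neutral_cong_right finite_peak_values)
      (auto simp: peak_values_def compositions_0)
  finally have "real_of_int (hsp n 3) =
      (\<Sum>(m, b) | 0 < b \<and> b < m \<and> 2 * b + m = n. real m - real b)"
    by (simp add: case_prod_unfold)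
  also have "\<dots> = (\<Sum>m | m \<in> {2..int n - 2} \<and> even (int n - m) \<and> int n < 3 * m.
      (3 * of_int m - real n) / 2)"
  proof (rule sum.reindex_bij_witness[where
        j = "\<lambda>(m, b). int m" and i = "\<lambda>m. (nat m, nat ((int n - m) div 2))"], goal_cases)
    case (4 m)
    then obtain c where "int n - m = 2 * c"
      by blast
    then show ?case
      using 4 by auto
  qed auto
  also have "\<dots> = (\<Sum>m = 2..int n - 2. mid_height n m)"
    unfolding mid_height_eq by (rule sum.inter_filter) simp
  finally show ?thesis .
qed

theorem theorem4:
  fixes n :: nat
  shows "(\<forall>k::nat. k > 3 \<longrightarrow>
           hsp n k = (int k - 2) *
             (\<Sum>m = 2..int n - int k + 1.
                let t = \<lfloor>(of_int (int n - m - int k + 3) :: real) / 2\<rfloor> in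
                \<Sum>b = 1..min (m - 1) t.
                  int (nat (int n - 2 * b - m - 1) choose (k - 4)) * (m - b)))
       \<and> real_of_int (hsp n 3) = (\<Sum>m = 2..int n - 2. mid_height n m)"
proof -
  have floor_half: "\<lfloor>real_of_int a / 2\<rfloor> = a div 2" for a
    using floor_divide_of_int_eq[of a 2, where ?'a = real] by simp
  show ?thesis
    unfolding Let_def floor_half
    using hsp_more_than_three_parts hsp_three_parts by blast
qed

end
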